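(* Let $T>0$, $\Omega=\mathbb{R}^d\times[0,T]$, $r=|x|=\big(\sum_{i=1}^dx_i^2\big)^{1/2}$, and let $P$ be a polynomial. Let $u$ be a continuous function on $\Omega$ for which there are constants $a_0>0$, $C$ and a function $\epsilon$ with $\lim_{r\to\infty}\epsilon(r)=0$ such that $$0<a_0\le P(u(x,t))\le\epsilon(r)\,r^2+C\quad\text{for all }(x,t)\in\Omega .$$ Let $v$ be of class $\mathcal{C}^{2,1}$ on $\Omega$ with $v(x,t)>-m$ on $\Omega$ for some constant $m>0$. If $$\frac{\partial v}{\partial t}-P(u)\Delta v\ge0\quad\text{in }\mathbb{R}^d\times(0,T]$$ and $v(x,0)>0$ for all $x\in\mathbb{R}^d$, then $v(x,t)\ge0$ for all $(x,t)\in\Omega$.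
   Context: $v$ of class $\mathcal{C}^{2,1}$ on $\Omega$ means: $v$ is continuous on $\mathbb{R}^d\times[0,T]$ and has continuous second derivatives in $x$ and continuous first derivative in $t$ on $\mathbb{R}^d\times(0,T]$ (one-sided in $t$ at $t=T$). $\Delta$ is the Laplacian in $x$. *)

theory Defs
  imports "HOL-Analysis.Analysis" "HOL-Computational_Algebra.Polynomial"
begin

definition has_partial :: "'n::finite \<Rightarrow> (real ^ 'n \<Rightarrow> real) \<Rightarrow> real ^ 'n \<Rightarrow> bool" where
  "has_partial i f x \<longleftrightarrow> (\<lambda>s. f (x + s *\<^sub>R axis i 1)) field_differentiable (at 0)"

definition partial :: "'n::finite \<Rightarrow> (real ^ 'n \<Rightarrow> real) \<Rightarrow> real ^ 'n \<Rightarrow> real" where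
  "partial i f x = deriv (\<lambda>s. f (x + s *\<^sub>R axis i 1)) 0"

definition laplacian :: "(real ^ 'n::finite \<Rightarrow> real) \<Rightarrow> real ^ 'n \<Rightarrow> real" where
  "laplacian f x = (\<Sum>i\<in>UNIV. partial i (partial i f) x)"

text \<open>The derivative in time is taken within the interval from 0 to T, so that it is the
  ordinary derivative for \<open>0 < t < T\<close> and the left derivative at \<open>t = T\<close>; no value of
  the function outside the time interval is involved.\<close>

definition time_deriv :: "real \<Rightarrow> (real ^ 'n::finite \<Rightarrow> real \<Rightarrow> real) \<Rightarrow> real ^ 'n \<Rightarrow> real \<Rightarrow> real" where
  "time_deriv T v x t = vector_derivative (v x) (at t within {0..T})"

definition class_C21 :: "real \<Rightarrow> (real ^ 'n::finite \<Rightarrow> real \<Rightarrow> real) \<Rightarrow> bool" where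
  "class_C21 T v \<longleftrightarrow>
     continuous_on (UNIV \<times> {0..T}) (\<lambda>(x, t). v x t) \<and>
     (\<forall>x. \<forall>t\<in>{0<..T}. \<forall>i. has_partial i (\<lambda>y. v y t) x) \<and>
     (\<forall>x. \<forall>t\<in>{0<..T}. \<forall>i j. has_partial i (partial j (\<lambda>y. v y t)) x) \<and>
     (\<forall>i j. continuous_on (UNIV \<times> {0<..T}) (\<lambda>(x, t). partial i (partial j (\<lambda>y. v y t)) x)) \<and>
     (\<forall>x. \<forall>t\<in>{0<..T}. v x differentiable (at t within {0..T})) \<and>
     continuous_on (UNIV \<times> {0<..T}) (\<lambda>(x, t). time_deriv T v x t)"

end

theory Submission
  imports Defs
begin

text \<open>The hypotheses give a bound \<open>P(u) \<le> K (1 + |x|\<^sup>2)\<close>. For \<open>\<delta> > 0\<close> and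
  \<open>L = 2 d K + 1\<close>, the function \<open>w = v + \<delta> e\<^sup>L\<^sup>t (1 + |x|\<^sup>2)\<close> is a strict supersolution,
  positive at \<open>t = 0\<close> and, because \<open>v > -m\<close>, outside a large ball. A negative value of \<open>w\<close> would
  therefore force a minimum over space at some time \<open>t > 0\<close>, where \<open>w\<^sub>t \<le> 0\<close> and
  \<open>\<Delta>w \<ge> 0\<close>, contradicting strictness. Hence \<open>w \<ge> 0\<close>, and \<open>\<delta> \<rightarrow> 0\<close> gives the claim.\<close>

text \<open>The minimum makes \<open>f' a = 0\<close>. If \<open>D < 0\<close>, then
  \<open>f'\<close> is negative just to the right of \<open>a\<close>, so \<open>f\<close> drops
  below \<open>f a\<close> there.\<close>

lemma second_deriv_nonneg_at_min:
  fixes f f' :: "real \<Rightarrow> real"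
  assumes f': "\<And>s. (f has_real_derivative f' s) (at s)"
    and D: "(f' has_real_derivative D) (at a)"
    and min: "\<And>s. f a \<le> f s"
  shows "D \<ge> 0"
proof (rule ccontr)
  assume "\<not> D \<ge> 0"
  then obtain d where d: "d > 0" "\<And>h. 0 < h \<Longrightarrow> h < d \<Longrightarrow> f' (a + h) < f' a"
    using DERIV_neg_dec_right[OF D] by auto
  have crit: "f' a = 0"
    using DERIV_local_min[OF f'[of a], of 1] min by auto
  have "f (a + d/2) < f a"
  proof (rule DERIV_neg_imp_decreasing_open[of a "a + d/2" f])
    show "a < a + d/2" using d(1) by simp
  next
    fix x assume "a < x" "x < a + d/2"
    then have "f' x < 0" using d(2)[of "x - a"] crit d(1) by auto
    then show "\<exists>y. (f has_real_derivative y) (at x) \<and> y < 0" using f' by blast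
  next
    show "continuous_on {a..a + d/2} f"
      by (meson DERIV_isCont continuous_at_imp_continuous_on f')
  qed
  with min[of "a + d/2"] show False by simp
qed

text \<open>A positive derivative would give smaller values just to the left of \<open>b\<close>.
  Comparing with the left side only admits \<open>b = c\<close>, which is the case of a minimum at
  the final time.\<close>

lemma left_deriv_nonpos_at_min:
  fixes f :: "real \<Rightarrow> real"
  assumes D: "(f has_real_derivative D) (at b within {a..c})"
    and "a < b" "b \<le> c"
    and min: "\<And>s. s \<in> {a..b} \<Longrightarrow> f b \<le> f s"
  shows "D \<le> 0"
proof (rule ccontr)
  assume "\<not> D \<le> 0"
  then obtain d where d: "d > 0" "\<And>h. h > 0 \<Longrightarrow> b - h \<in> {a..c} \<Longrightarrow> h < d \<Longrightarrow> f (b - h) < f b"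
    using has_real_derivative_pos_inc_left[OF D] by auto
  define h where "h = min (d/2) (b - a)"
  have "h > 0" "h < d" "b - h \<in> {a..b}"
    using d(1) \<open>a < b\<close> by (auto simp: h_def min_def)
  then show False
    using d(2)[of h] min[of "b - h"] \<open>b \<le> c\<close> by auto
qed

text \<open>\<open>partial\<close> is a derivative at parameter 0. Moving the base point along the
  axis turns it into a derivative at every parameter; applied to \<open>partial i g\<close> as well,
  this yields second derivatives along the line.\<close>

lemma line_has_partial_derivative:
  fixes g :: "real ^ 'n::finite \<Rightarrow> real"
  assumes "\<And>y. has_partial i g y"
  shows "((\<lambda>s. g (x + s *\<^sub>R axis i 1)) has_real_derivative partial i g (x + s *\<^sub>R axis i 1)) (at s)"
proof -
  have "((\<lambda>h. g (x + s *\<^sub>R axis i 1 + h *\<^sub>R axis i 1)) has_real_derivative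
          partial i g (x + s *\<^sub>R axis i 1)) (at 0)"
    using assms[of "x + s *\<^sub>R axis i 1"]
    unfolding has_partial_def partial_def by (simp add: DERIV_deriv_iff_field_differentiable)
  then have "((\<lambda>h. g (x + (h + s) *\<^sub>R axis i 1)) has_real_derivative
          partial i g (x + s *\<^sub>R axis i 1)) (at 0)"
    by (simp add: algebra_simps)
  then show ?thesis
    using DERIV_shift[of "\<lambda>s. g (x + s *\<^sub>R axis i 1)" _ 0 s] by simp
qed

lemma norm_add_axis_squared:
  fixes x :: "real ^ 'n::finite"
  shows "(norm (x + s *\<^sub>R axis i 1))\<^sup>2 = (norm x)\<^sup>2 + 2 * s * x $ i + s\<^sup>2"
  unfolding power2_norm_eq_inner
  by (simp add: inner_add_left inner_add_right inner_axis inner_axis' power2_eq_square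
      algebra_simps)

text \<open>Restricted to each axis line through \<open>x\<close>, the perturbed function has a
  minimum at parameter 0, where its second derivative is the pure second partial of \<open>g\<close>
  plus \<open>2 * c\<close>. Summing over the axes gives the bound.\<close>

lemma laplacian_at_min_of_quadratic_perturbation:
  fixes g :: "real ^ 'n::finite \<Rightarrow> real"
  assumes p1: "\<And>i y. has_partial i g y"
    and p2: "\<And>i y. has_partial i (partial i g) y"
    and min: "\<And>y. g x + c * (1 + (norm x)\<^sup>2) \<le> g y + c * (1 + (norm y)\<^sup>2)"
  shows "laplacian g x \<ge> - (2 * real CARD('n) * c)"
proof -
  have "partial i (partial i g) x + 2 * c \<ge> 0" for i
  proof (rule second_deriv_nonneg_at_min)
    let ?f = "\<lambda>s. g (x + s *\<^sub>R axis i 1) + c * (1 + ((norm x)\<^sup>2 + 2 * s * x $ i + s\<^sup>2))"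
    let ?f' = "\<lambda>s. partial i g (x + s *\<^sub>R axis i 1) + c * (2 * x $ i + 2 * s)"
    show "(?f has_real_derivative ?f' s) (at s)" for s
      by (rule DERIV_add[OF line_has_partial_derivative[OF p1]])
        (auto intro!: derivative_eq_intros simp: algebra_simps)
    have "((\<lambda>s. partial i g (x + s *\<^sub>R axis i 1)) has_real_derivative
            partial i (partial i g) x) (at 0)"
      using line_has_partial_derivative[OF p2, of i x 0] by simp
    then show "(?f' has_real_derivative partial i (partial i g) x + 2 * c) (at 0)"
      by (rule DERIV_add) (auto intro!: derivative_eq_intros)
    show "?f 0 \<le> ?f s" for s
      using min[of "x + s *\<^sub>R axis i 1"] by (simp add: norm_add_axis_squared)
  qed
  then have "(\<Sum>i\<in>(UNIV::'n set). partial i (partial i g) x + 2 * c) \<ge> 0"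
    by (simp add: sum_nonneg)
  then show ?thesis
    by (simp add: laplacian_def sum.distrib)
qed

text \<open>Far out, \<open>\<epsilon> < 1\<close> bounds \<open>q\<close> by
  \<open>(norm x)\<^sup>2 + C\<close>; on the remaining compact cylinder \<open>q\<close> is bounded
  by continuity.\<close>

lemma quadratic_growth_bound:
  fixes q :: "real ^ 'n::finite \<Rightarrow> real \<Rightarrow> real"
  assumes cont: "continuous_on (UNIV \<times> {0..T}) (\<lambda>(x, t). q x t)"
    and \<epsilon>: "(\<epsilon> \<longlongrightarrow> 0) at_top"
    and le: "\<And>x t. t \<in> {0..T} \<Longrightarrow> q x t \<le> \<epsilon> (norm x) * (norm x)\<^sup>2 + C"
  obtains K where "K > 0" "\<And>x t. t \<in> {0..T} \<Longrightarrow> q x t \<le> K * (1 + (norm x)\<^sup>2)"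
proof -
  obtain R where R: "\<And>r. r \<ge> R \<Longrightarrow> \<epsilon> r < 1"
    using order_tendstoD(2)[OF \<epsilon>, of 1] by (auto simp: eventually_at_top_linorder)
  have "compact ((\<lambda>(x, t). q x t) ` (cball 0 R \<times> {0..T}))"
    by (intro compact_continuous_image continuous_on_subset[OF cont] compact_Times) auto
  then have "bounded ((\<lambda>(x, t). q x t) ` (cball 0 R \<times> {0..T}))"
    by (rule compact_imp_bounded)
  then obtain B where B: "\<And>x t. norm x \<le> R \<Longrightarrow> t \<in> {0..T} \<Longrightarrow> norm (q x t) \<le> B"
    unfolding bounded_iff by fastforce
  \<comment> \<open>The summand 1 absorbs the coefficient of \<open>(norm x)\<^sup>2\<close> far
    out, the others absorb the constants of the two regions.\<close>
  define K where "K = 1 + \<bar>B\<bar> + \<bar>C\<bar>"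
  show ?thesis
  proof
    show "K > 0" by (simp add: K_def)
    fix x :: "real ^ 'n" and t assume t: "t \<in> {0..T}"
    have Kn: "K \<le> K * (1 + (norm x)\<^sup>2)" "(norm x)\<^sup>2 \<le> K * (norm x)\<^sup>2"
      by (auto simp: K_def algebra_simps)
    show "q x t \<le> K * (1 + (norm x)\<^sup>2)"
    proof (cases "norm x \<le> R")
      case True
      with B[OF True t] Kn show ?thesis by (auto simp: K_def)
    next
      case False
      then have "\<epsilon> (norm x) * (norm x)\<^sup>2 \<le> 1 * (norm x)\<^sup>2"
        using R[of "norm x"] by (intro mult_right_mono) auto
      moreover have "C \<le> K" by (simp add: K_def)
      ultimately show ?thesis
        using le[OF t, of x] Kn(2) by (auto simp: algebra_simps)
    qed
  qed
qed

lemma supersolution_barrier_nonneg: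
  fixes v q :: "real ^ 'n::finite \<Rightarrow> real \<Rightarrow> real"
  assumes C21: "class_C21 T v"
    and lower: "\<And>x t. t \<in> {0..T} \<Longrightarrow> v x t > - m"
    and super: "\<And>x t. t \<in> {0<..T} \<Longrightarrow> time_deriv T v x t - q x t * laplacian (\<lambda>y. v y t) x \<ge> 0"
    and init: "\<And>x. v x 0 > 0"
    and q0: "\<And>x t. t \<in> {0..T} \<Longrightarrow> 0 \<le> q x t"
    and qK: "\<And>x t. t \<in> {0..T} \<Longrightarrow> q x t \<le> K * (1 + (norm x)\<^sup>2)"
    and "K > 0" "\<delta> > 0"
    and L: "L = 2 * real CARD('n) * K + 1"
    and t1: "t1 \<in> {0..T}"
  shows "v x1 t1 + \<delta> * exp (L * t1) * (1 + (norm x1)\<^sup>2) \<ge> 0"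
proof (rule ccontr)
  define w where "w x t = v x t + \<delta> * exp (L * t) * (1 + (norm x)\<^sup>2)" for x t
  assume "\<not> ?thesis"
  then have neg: "w x1 t1 < 0" by (simp add: w_def)
  have "L > 0" using \<open>K > 0\<close> by (simp add: L add_nonneg_pos)
  \<comment> \<open>\<open>norm x1\<close> puts the point of negativity inside the ball,
    \<open>\<bar>m\<bar> / \<delta>\<close> lets the barrier outweigh \<open>-m\<close> outside it,
    and 1 ensures \<open>R \<le> R\<^sup>2\<close>.\<close>
  define R where "R = norm x1 + \<bar>m\<bar> / \<delta> + 1"
  have far: "w x t > 0" if "t \<in> {0..T}" "norm x \<ge> R" for x t
  proof -
    have R1: "R \<ge> 1" using \<open>\<delta> > 0\<close> by (simp add: R_def)
    then have "R \<le> R\<^sup>2" by (simp add: power2_eq_square)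
    also have "\<dots> \<le> (norm x)\<^sup>2" using that R1 by (intro power_mono) auto
    finally have "\<bar>m\<bar> / \<delta> \<le> 1 + (norm x)\<^sup>2"
      using norm_ge_zero[of x1] unfolding R_def by linarith
    then have "\<bar>m\<bar> \<le> \<delta> * 1 * (1 + (norm x)\<^sup>2)"
      using \<open>\<delta> > 0\<close> by (simp add: field_simps)
    \<comment> \<open>Here \<open>exp (L * t) \<ge> 1\<close>, since \<open>L > 0\<close> and
      \<open>t \<ge> 0\<close>.\<close>
    also have "\<dots> \<le> \<delta> * exp (L * t) * (1 + (norm x)\<^sup>2)"
      using \<open>\<delta> > 0\<close> \<open>L > 0\<close> that by (intro mult_right_mono mult_left_mono) auto
    finally show ?thesis using lower[OF that(1), of x] by (simp add: w_def)
  qed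
  have vcont: "continuous_on (UNIV \<times> {0..T}) (\<lambda>(x, t). v x t)"
    using C21 by (simp add: class_C21_def)
  have "continuous_on (cball 0 R \<times> {0..T}) (\<lambda>z. v (fst z) (snd z))"
    using continuous_on_subset[OF vcont, of "cball 0 R \<times> {0..T}"] by (auto simp: case_prod_beta)
  then have "continuous_on (cball 0 R \<times> {0..T}) (\<lambda>z. w (fst z) (snd z))"
    unfolding w_def by (intro continuous_intros)
  moreover have x1R: "(x1, t1) \<in> cball 0 R \<times> {0..T}"
    using t1 \<open>\<delta> > 0\<close> by (auto simp: R_def)
  ultimately obtain z where z: "z \<in> cball 0 R \<times> {0..T}"
    "\<forall>y\<in>cball 0 R \<times> {0..T}. w (fst z) (snd z) \<le> w (fst y) (snd y)"
    using continuous_attains_inf[of "cball 0 R \<times> {0..T}" "\<lambda>z. w (fst z) (snd z)"]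
      compact_Times[OF compact_cball compact_Icc] by blast
  obtain x0 t0 where [simp]: "z = (x0, t0)" by fastforce
  have t0: "t0 \<in> {0..T}" using z(1) by auto
  have min_ball: "w x0 t0 \<le> w x t" if "norm x \<le> R" "t \<in> {0..T}" for x t
    using bspec[OF z(2), of "(x, t)"] that by auto
  have neg0: "w x0 t0 < 0"
    using min_ball[of x1 t1] x1R t1 neg by auto
  \<comment> \<open>Outside the ball \<open>w\<close> is positive, so the negative minimum over the
    compact cylinder is global in space.\<close>
  have min: "w x0 t0 \<le> w x t" if "t \<in> {0..T}" for x t
    using min_ball[of x t] far[of t x] that neg0 by (cases "norm x \<le> R") auto
  have "w x0 0 > 0"
    using init[of x0] \<open>\<delta> > 0\<close> by (simp add: w_def add_pos_nonneg)
  then have "t0 \<noteq> 0" using neg0 by auto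
  with t0 have t0': "t0 \<in> {0<..T}" by auto
  define c where "c = \<delta> * exp (L * t0)"
  define S where "S = 1 + (norm x0)\<^sup>2"
  have "c > 0" using \<open>\<delta> > 0\<close> by (simp add: c_def)
  have "S \<ge> 1" by (simp add: S_def)
  have lap: "laplacian (\<lambda>y. v y t0) x0 \<ge> - (2 * real CARD('n) * c)"
  proof (rule laplacian_at_min_of_quadratic_perturbation)
    show "v x0 t0 + c * (1 + (norm x0)\<^sup>2) \<le> v y t0 + c * (1 + (norm y)\<^sup>2)" for y
      using min[OF t0, of y] by (simp add: w_def c_def)
  qed (use C21 t0' in \<open>auto simp: class_C21_def\<close>)
  have "v x0 differentiable (at t0 within {0..T})"
    using C21 t0' by (auto simp: class_C21_def)
  then have "(v x0 has_real_derivative time_deriv T v x0 t0) (at t0 within {0..T})"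
    unfolding time_deriv_def has_real_derivative_iff_has_vector_derivative
    by (simp add: vector_derivative_works)
  then have "(w x0 has_real_derivative time_deriv T v x0 t0 + L * c * S) (at t0 within {0..T})"
    unfolding w_def [abs_def] c_def S_def
    by (rule DERIV_add) (auto intro!: derivative_eq_intros)
  \<comment> \<open>\<open>L * c * S\<close> is the time derivative of the barrier at the minimum.
    Only times up to \<open>t0\<close> are compared, so \<open>t0 = T\<close> is covered.\<close>
  then have "time_deriv T v x0 t0 + L * c * S \<le> 0"
    by (rule left_deriv_nonpos_at_min) (use t0' min in auto)
  moreover have "time_deriv T v x0 t0 \<ge> q x0 t0 * laplacian (\<lambda>y. v y t0) x0"
    using super[OF t0', of x0] by simp
  moreover have "q x0 t0 * laplacian (\<lambda>y. v y t0) x0 \<ge> q x0 t0 * - (2 * real CARD('n) * c)"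
    using lap q0[OF t0] by (intro mult_left_mono) auto
  moreover have "q x0 t0 * (2 * real CARD('n) * c) \<le> K * S * (2 * real CARD('n) * c)"
    using qK[OF t0, of x0] \<open>c > 0\<close> by (intro mult_right_mono) (auto simp: S_def)
  \<comment> \<open>The summand 1 in \<open>L\<close> leaves the surplus \<open>c * S\<close>: the
    preceding bounds give \<open>time_deriv T v x0 t0 + L * c * S \<ge> c * S > 0\<close>, against
    its being at most 0.\<close>
  moreover have "L * c * S = K * S * (2 * real CARD('n) * c) + c * S"
    by (simp add: L algebra_simps)
  moreover have "c * S > 0" using \<open>c > 0\<close> \<open>S \<ge> 1\<close> by simp
  ultimately show False by linarith
qed

theorem lemma5:
  fixes T a0 C m :: real
    and P :: "real poly"
    and \<epsilon> :: "real \<Rightarrow> real"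
    and u v :: "real ^ 'n::finite \<Rightarrow> real \<Rightarrow> real"
  assumes "T > 0"
    and "continuous_on (UNIV \<times> {0..T}) (\<lambda>(x, t). u x t)"
    and "a0 > 0"
    and "(\<epsilon> \<longlongrightarrow> 0) at_top"
    and "\<And>x t. t \<in> {0..T} \<Longrightarrow> a0 \<le> poly P (u x t)"
    and "\<And>x t. t \<in> {0..T} \<Longrightarrow> poly P (u x t) \<le> \<epsilon> (norm x) * (norm x)\<^sup>2 + C"
    and "class_C21 T v"
    and "m > 0"
    and "\<And>x t. t \<in> {0..T} \<Longrightarrow> v x t > - m"
    and "\<And>x t. t \<in> {0<..T} \<Longrightarrow>
           time_deriv T v x t - poly P (u x t) * laplacian (\<lambda>y. v y t) x \<ge> 0"
    and "\<And>x. v x 0 > 0"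
  shows "\<forall>x. \<forall>t\<in>{0..T}. v x t \<ge> 0"
proof (intro allI ballI)
  fix x :: "real ^ 'n" and t assume t: "t \<in> {0..T}"
  have "continuous_on (UNIV \<times> {0..T}) (\<lambda>(x, t). poly P (u x t))"
    using assms(2) by (auto simp: case_prod_beta intro!: continuous_intros)
  then obtain K where K: "K > 0"
    "\<And>x t. t \<in> {0..T} \<Longrightarrow> poly P (u x t) \<le> K * (1 + (norm x)\<^sup>2)"
    using quadratic_growth_bound[where q = "\<lambda>x t. poly P (u x t)", OF _ assms(4,6)] by blast
  have pos: "0 \<le> poly P (u x t)" if "t \<in> {0..T}" for x t
    using assms(3) assms(5)[OF that, of x] by linarith
  define L where "L = 2 * real CARD('n) * K + 1"
  \<comment> \<open>\<open>A\<close> is the barrier at the fixed point \<open>(x, t)\<close> for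
    \<open>\<delta> = 1\<close>; the choice \<open>\<delta> = e / A\<close> makes it contribute
    exactly \<open>e\<close> there.\<close>
  define A where "A = exp (L * t) * (1 + (norm x)\<^sup>2)"
  have "A > 0" by (simp add: A_def add_pos_nonneg)
  show "v x t \<ge> 0"
  proof (rule field_le_epsilon)
    fix e :: real assume "e > 0"
    then have "v x t + e / A * exp (L * t) * (1 + (norm x)\<^sup>2) \<ge> 0"
      using \<open>A > 0\<close>
      by (intro supersolution_barrier_nonneg[OF assms(7,9-11) pos K(2) K(1) _ L_def t]) auto
    moreover have "e / A * exp (L * t) * (1 + (norm x)\<^sup>2) = e / A * A"
      by (simp add: A_def)
    ultimately show "0 \<le> v x t + e" using \<open>A > 0\<close> by simp
  qed
qed

end
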